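(* Let $A^*\ge 9.5$, $\epsilon=0.1$, and $A(n)=A^*+\epsilon\cos(n)$ for $n\in\mathbb{Z}$. Then the nonautonomous H\'enon map $\lbrace f_n\rbrace_{n\in\mathbb{Z}}$, $$f_n(x,y)=(A(n)-y-x^2,\;x),\qquad (x,y)\in\mathbb{R}^2,$$ has a nonautonomous chaotic invariant set in $\mathbb{R}^2$ (in the sense defined in the context).
   Context: Nonautonomous dynamics is given by a sequence $\lbrace f_n,D_n\rbrace_{n=-\infty}^{+\infty}$ of maps $f_n$ and closed bounded domains $D_n\subset\mathbb{R}^2$. Each $D_n$ contains pairwise disjoint vertical strips $V_1^n,\dots,V_N^n$, and the transition matrices $A^n=(A^n_{ij})_{1\le i,j\le N}$ are $A^n_{ij}=1$ if $f_n(V_i^n)\cap V_j^{n+1}\ne\emptyset$ and $A^n_{ij}=0$ otherwise. (A $\mu_v$-vertical strip is a set $\{(x,y): v_1(y)\le x\le v_2(y),\ y\in I_y\}$, where $I_y$ is a closed interval and $v_1<v_2$ are $\mu_v$-Lipschitz functions on $I_y$ whose graphs $\{(v_k(y),y)\}$ lie in the domain.) $\Sigma^N_{\lbrace A^n\rbrace}$ denotes the set of bi-infinite sequences $s=(\cdots s_{n-2}s_{n-1}.s_ns_{n+1}\cdots)$ with $s_l\in\{1,\dots,N\}$ for all $l\in\mathbb{Z}$ and $A^n_{s_ns_{n+1}}=1$ for all $n\in\mathbb{Z}$, with the usual (product) topology; $\sigma$ is the shift map $\sigma(\cdots s_{n-1}.s_ns_{n+1}\cdots)=(\cdots s_{n-1}s_n.s_{n+1}\cdots)$,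 and the extended shift is $\tilde\sigma(s,n)=(\sigma(s),n+1)$. Also $f(x,y;n)=(f_n(x,y),n+1)$. A nonautonomous chaotic (invariant) set for $\lbrace f_n,D_n\rbrace$ is a sequence of sets $\Lambda_n\subset D_n$, $n\in\mathbb{Z}$, with $f_n(\Lambda_n)=\Lambda_{n+1}$, for which there are homeomorphisms $\phi_n$ of $\Lambda_n$ onto $\Sigma^N_{\lbrace A^n\rbrace}$ such that, with $\phi(x,y;n)=(\phi_n(x,y),n)$, one has $\phi\circ f=\tilde\sigma\circ\phi$; that is, $\phi_{n+1}\circ f_n=\sigma\circ\phi_n$ on $\Lambda_n$ for all $n\in\mathbb{Z}$. For the nonautonomous H\'enon map, the paper's setting is: domains $D_n$ each containing a pair of vertical strips ($N=2$), with transition matrices $A^n=\begin{pmatrix}1&1\\1&1\end{pmatrix}$ for every $n$, so that $\Sigma^N_{\lbrace A^n\rbrace}$ is the space $\{1,2\}^{\mathbb{Z}}$ of all bi-infinite sequences of two symbols. *)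

theory Defs
  imports "HOL-Analysis.Analysis"
begin

type_synonym plane = "real \<times> real"

(* A closed domain is the closure of a nonempty connected open set. The bound is asked
   to be uniform in n: with a bound for each n separately, an injective f n could push any
   Cantor set forward to a "chaotic set" whose pieces drift off to infinity. *)
definition closed_bounded_domains :: "(int \<Rightarrow> plane set) \<Rightarrow> bool" where
  "closed_bounded_domains D \<longleftrightarrow>
     (\<forall>n. \<exists>U. open U \<and> connected U \<and> U \<noteq> {} \<and> D n = closure U) \<and>
     bounded (\<Union>n. D n)"

(* The interval {a..b} is the I_y of the strip, required to be nondegenerate. *)
definition vertical_strip :: "real \<Rightarrow> plane set \<Rightarrow> plane set \<Rightarrow> bool" where
  "vertical_strip \<mu> D V \<longleftrightarrow>
     (\<exists>a b v1 v2. a < b \<and>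
        \<mu>-lipschitz_on {a..b} v1 \<and> \<mu>-lipschitz_on {a..b} v2 \<and>
        (\<forall>y\<in>{a..b}. v1 y < v2 y \<and> (v1 y, y) \<in> D \<and> (v2 y, y) \<in> D) \<and>
        V = {(x, y). y \<in> {a..b} \<and> v1 y \<le> x \<and> x \<le> v2 y})"

definition vertical_strips ::
    "real \<Rightarrow> nat \<Rightarrow> (int \<Rightarrow> plane set) \<Rightarrow> (int \<Rightarrow> nat \<Rightarrow> plane set) \<Rightarrow> bool" where
  "vertical_strips \<mu> N D V \<longleftrightarrow>
     (\<forall>n. (\<forall>i\<in>{1..N}. vertical_strip \<mu> (D n) (V n i) \<and> V n i \<subseteq> D n) \<and>
          (\<forall>i\<in>{1..N}. \<forall>j\<in>{1..N}. i \<noteq> j \<longrightarrow> V n i \<inter> V n j = {}))"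

definition transition_matrix ::
    "(int \<Rightarrow> plane \<Rightarrow> plane) \<Rightarrow> (int \<Rightarrow> nat \<Rightarrow> plane set) \<Rightarrow> int \<Rightarrow> nat \<Rightarrow> nat \<Rightarrow> nat" where
  "transition_matrix f V n i j = (if f n ` V n i \<inter> V (n + 1) j \<noteq> {} then 1 else 0)"

(* The sequences whose point stands at time n: the symbol written s_(n+k) on paper is s k
   here, so that s 0 is the symbol just to the right of the point. Moving the point is then
   reindexing, and it maps the sequences at time n onto those at time n + 1. If A does not
   depend on n, neither does symbol_space N A n. Its topology is the product topology of
   the type int => nat. *)
definition symbol_space :: "nat \<Rightarrow> (int \<Rightarrow> nat \<Rightarrow> nat \<Rightarrow> nat) \<Rightarrow> int \<Rightarrow> (int \<Rightarrow> nat) set" where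
  "symbol_space N A n =
     {s. (\<forall>k. s k \<in> {1..N}) \<and> (\<forall>k. A (n + k) (s k) (s (k + 1)) = 1)}"

definition shift :: "(int \<Rightarrow> nat) \<Rightarrow> int \<Rightarrow> nat" where
  "shift s = (\<lambda>k. s (k + 1))"

definition nonautonomous_chaotic_set ::
    "(int \<Rightarrow> plane \<Rightarrow> plane) \<Rightarrow> (int \<Rightarrow> plane set) \<Rightarrow> nat \<Rightarrow> (int \<Rightarrow> nat \<Rightarrow> nat \<Rightarrow> nat)
      \<Rightarrow> (int \<Rightarrow> plane set) \<Rightarrow> bool" where
  "nonautonomous_chaotic_set f D N A \<Lambda> \<longleftrightarrow>
     (\<forall>n. \<Lambda> n \<subseteq> D n) \<and>
     (\<forall>n. f n ` \<Lambda> n = \<Lambda> (n + 1)) \<and>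
     (\<exists>\<phi> \<psi>. (\<forall>n. homeomorphism (\<Lambda> n) (symbol_space N A n) (\<phi> n) (\<psi> n)) \<and>
             (\<forall>n. \<forall>p\<in>\<Lambda> n. \<phi> (n + 1) (f n p) = shift (\<phi> n p)))"

definition henon :: "(int \<Rightarrow> real) \<Rightarrow> int \<Rightarrow> plane \<Rightarrow> plane" where
  "henon A n = (\<lambda>(x, y). (A n - y - x\<^sup>2, x))"

end

theory Submission
  imports Defs
begin

text \<open>
  Write \<open>p\<^sub>n = (x\<^sub>n, x\<^sub>n\<^sub>-\<^sub>1)\<close>. Then \<open>p\<^sub>n\<close> is an orbit of the maps if and only if
  \<open>x\<^sub>n\<^sup>2 = A\<^sub>n - x\<^sub>n\<^sub>-\<^sub>1 - x\<^sub>n\<^sub>+\<^sub>1\<close> for all \<open>n\<close>. Extracting the root leaves only a choice of sign at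
  every time, and this choice is the symbol sequence: \<open>1\<close> for the positive root and \<open>2\<close> for the
  negative one. So the orbits with code \<open>s\<close> are the fixed points of the operator
  \<open>T\<^sub>s(x)\<^sub>n = \<plusminus> sqrt (A\<^sub>n - x\<^sub>n\<^sub>-\<^sub>1 - x\<^sub>n\<^sub>+\<^sub>1)\<close> (called \<open>solve\<close> below) on the box of
  sequences in \<open>[-R, R]\<close>. Let \<open>a \<le> A\<^sub>n \<le> b\<close> for all \<open>n\<close>. For \<open>R = 1 + sqrt (1 + b)\<close> the box is
  mapped into itself, and all values are at least \<open>c > 0\<close> in modulus, where \<open>c\<^sup>2 = a - 2R\<close>.

  For parameters near \<open>9.5\<close>, the operator need not contract the supremum norm: its Lipschitz
  constant is about \<open>1 / c\<close> and the bound for \<open>c\<close> is below \<open>1\<close>. But its square does contract.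
  A small value \<open>T\<^sub>s(y)\<^sub>n\<close> forces both neighbours \<open>y\<^sub>n\<^sub>-\<^sub>1\<close> and \<open>y\<^sub>n\<^sub>+\<^sub>1\<close> to be near \<open>R\<close>, and if
  \<open>y = T\<^sub>s(x)\<close>, the step from \<open>x\<close> to these neighbours was strongly contracting. The resulting
  rate is \<open>sqrt (2 / (c\<^sup>2 R))\<close> (\<open>contraction_inequality\<close>, \<open>solve_solve_diff\<close>).

  Everything follows from this estimate, which is local in time. Iterating the operator
  gives a unique orbit for each code (\<open>coded_orbit_exists\<close>, \<open>coded_orbit_unique\<close>). Two codes
  that agree on a long window around a time have orbits that are close at that time
  (\<open>coded_orbits_close\<close>), so the map from codes to points is continuous. It is injective because
  a point determines its orbit and the orbit shows its signs. As the space of codes is compact, the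
  map is a homeomorphism onto its image, and this image is the chaotic set. The strips are the
  parts \<open>c \<le> x \<le> R\<close> and \<open>-R \<le> x \<le> -c\<close> of the square.
\<close>

section \<open>Symbols and elementary inequalities\<close>

definition symbol_sign :: "nat \<Rightarrow> real" where
  "symbol_sign i = (if i = 1 then 1 else -1)"

lemma abs_symbol_sign [simp]: "\<bar>symbol_sign i\<bar> = 1"
  by (simp add: symbol_sign_def)

lemma inj_on_symbol_sign: "inj_on symbol_sign {1..2}"
  by (auto simp: inj_on_def symbol_sign_def split: if_splits)

lemma abs_diff_sqrt:
  fixes a b :: real
  assumes "a > 0" "b > 0"
  shows "\<bar>sqrt a - sqrt b\<bar> = \<bar>a - b\<bar> / (sqrt a + sqrt b)"
proof -
  have "(sqrt a - sqrt b) * (sqrt a + sqrt b) = a - b"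
    using assms by (simp add: algebra_simps)
  moreover have "sqrt a + sqrt b > 0" using assms by (simp add: add_pos_pos)
  ultimately show ?thesis
    by (metis abs_mult abs_of_pos nonzero_mult_div_cancel_right less_irrefl)
qed

text \<open>The chord of the convex function \<open>1 / x\<close> over \<open>[c, R]\<close> lies above its graph. Replacing
  reciprocals by chords makes the contraction estimate depend on a sum of two unknowns only.\<close>

lemma inverse_le_chord:
  fixes c R x :: real
  assumes "0 < c" "c \<le> x" "x \<le> R"
  shows "1 / x \<le> (c + R - x) / (c * R)"
proof -
  have "0 \<le> (x - c) * (R - x)" using assms by simp
  hence "c * R \<le> (c + R - x) * x" by (simp add: algebra_simps)
  thus ?thesis using assms by (simp add: field_simps)
qed

section \<open>The full shift\<close>

definition full_shift :: "nat \<Rightarrow> (int \<Rightarrow> nat) set" where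
  "full_shift N = {s. \<forall>k. s k \<in> {1..N}}"

lemma compact_full_shift: "compact (full_shift N)"
proof -
  have "compactin (product_topology (\<lambda>_::int. euclidean) UNIV) (\<Pi>\<^sub>E k\<in>UNIV. {1..N})"
    by (subst compactin_PiE) (auto intro!: finite_imp_compact)
  moreover have "full_shift N = (\<Pi>\<^sub>E k\<in>UNIV. {1..N})"
    by (auto simp: full_shift_def PiE_def Pi_def)
  ultimately show ?thesis by (simp add: euclidean_product_topology)
qed

lemma open_cylinder:
  fixes s :: "int \<Rightarrow> nat"
  assumes "finite F"
  shows "open {t. \<forall>k\<in>F. t k = s k}"
proof -
  have "open (\<Inter>k\<in>F. (\<lambda>t::int \<Rightarrow> nat. t k) -` {s k})"
    using assms
    by (intro open_INT ballI open_vimage continuous_on_product_coordinates)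
       (auto simp: open_discrete)
  moreover have "(\<Inter>k\<in>F. (\<lambda>t. t k) -` {s k}) = {t. \<forall>k\<in>F. t k = s k}" by auto
  ultimately show ?thesis by simp
qed

section \<open>The sign-choosing operator\<close>

text \<open>The conditions \<open>upper\<close> and \<open>lower\<close> confine the radicand \<open>A n - x (n - 1) - x (n + 1)\<close> to
  \<open>[c\<^sup>2, R\<^sup>2]\<close> when \<open>x\<close> has values in \<open>[-R, R]\<close>. The condition \<open>contracting\<close> says that the square
  of the operator below contracts; it is weaker than \<open>c > 1\<close>, under which the operator
  itself would contract.\<close>

locale henon_horseshoe =
  fixes A :: "int \<Rightarrow> real" and R c :: real
  assumes c_pos: "c > 0"
    and upper: "A n \<le> R\<^sup>2 - 2 * R"
    and lower: "c\<^sup>2 + 2 * R \<le> A n"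
    and R_ge_2: "R \<ge> 2"
    and contracting: "2 < c\<^sup>2 * R"
begin

lemma c_less_R: "c < R"
proof -
  have "c\<^sup>2 < R\<^sup>2" using lower[of 0] upper[of 0] R_ge_2 by linarith
  thus ?thesis using R_ge_2 by (simp add: power2_less_imp_less)
qed

definition in_box :: "(int \<Rightarrow> real) \<Rightarrow> bool" where
  "in_box x \<longleftrightarrow> (\<forall>n. \<bar>x n\<bar> \<le> R)"

text \<open>The recurrence of the orbits, solved for the middle term.\<close>

definition solve :: "(int \<Rightarrow> nat) \<Rightarrow> (int \<Rightarrow> real) \<Rightarrow> int \<Rightarrow> real" where
  "solve s x n = symbol_sign (s n) * sqrt (A n - x (n - 1) - x (n + 1))"

lemma radicand_bounds:
  assumes "in_box x"
  shows "c\<^sup>2 \<le> A n - x (n - 1) - x (n + 1)" "A n - x (n - 1) - x (n + 1) \<le> R\<^sup>2"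
proof -
  have "\<bar>x (n - 1)\<bar> \<le> R" "\<bar>x (n + 1)\<bar> \<le> R" using assms by (auto simp: in_box_def)
  thus "c\<^sup>2 \<le> A n - x (n - 1) - x (n + 1)" "A n - x (n - 1) - x (n + 1) \<le> R\<^sup>2"
    using lower[of n] upper[of n] by linarith+
qed

lemma abs_solve:
  assumes "in_box x"
  shows "\<bar>solve s x n\<bar> = sqrt (A n - x (n - 1) - x (n + 1))"
proof -
  have "0 \<le> A n - x (n - 1) - x (n + 1)"
    using radicand_bounds(1)[OF assms, of n] zero_le_power2[of c] by linarith
  thus ?thesis by (simp add: solve_def abs_mult)
qed

lemma solve_square:
  assumes "in_box x"
  shows "(solve s x n)\<^sup>2 = A n - x (n - 1) - x (n + 1)"
proof -
  have "0 \<le> A n - x (n - 1) - x (n + 1)"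
    using radicand_bounds(1)[OF assms, of n] zero_le_power2[of c] by linarith
  hence "\<bar>solve s x n\<bar>\<^sup>2 = A n - x (n - 1) - x (n + 1)" using abs_solve[OF assms] by simp
  thus ?thesis by simp
qed

lemma abs_solve_bounds:
  assumes "in_box x"
  shows "c \<le> \<bar>solve s x n\<bar>" "\<bar>solve s x n\<bar> \<le> R"
proof -
  show "c \<le> \<bar>solve s x n\<bar>"
    unfolding abs_solve[OF assms] by (rule real_le_rsqrt[OF radicand_bounds(1)[OF assms]])
  show "\<bar>solve s x n\<bar> \<le> R"
    unfolding abs_solve[OF assms]
    using real_le_lsqrt[OF _ radicand_bounds(2)[OF assms]] R_ge_2 by simp
qed

lemma in_box_solve: "in_box x \<Longrightarrow> in_box (solve s x)"
  using abs_solve_bounds(2) by (simp add: in_box_def)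

text \<open>A difference of square roots is the difference of the radicands over the sum of the roots.
  Keeping the actual roots in the denominator, instead of the bound \<open>2 * c\<close>, is what allows
  two steps together to do better than two separate worst cases.\<close>

lemma solve_diff:
  assumes "in_box x" "in_box y" "s n = t n"
  shows "\<bar>solve s x n - solve t y n\<bar> \<le>
    (\<bar>x (n - 1) - y (n - 1)\<bar> + \<bar>x (n + 1) - y (n + 1)\<bar>) / (\<bar>solve s x n\<bar> + \<bar>solve t y n\<bar>)"
proof -
  let ?a = "A n - x (n - 1) - x (n + 1)" and ?b = "A n - y (n - 1) - y (n + 1)"
  have "c\<^sup>2 > 0" using c_pos by simp
  hence pos: "?a > 0" "?b > 0"
    using radicand_bounds(1)[OF assms(1), of n] radicand_bounds(1)[OF assms(2), of n] by linarith+
  have "solve s x n - solve t y n = symbol_sign (s n) * (sqrt ?a - sqrt ?b)"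
    using assms(3) by (simp add: solve_def algebra_simps)
  hence "\<bar>solve s x n - solve t y n\<bar> = \<bar>sqrt ?a - sqrt ?b\<bar>" by (simp add: abs_mult)
  also have "\<dots> = \<bar>?a - ?b\<bar> / (sqrt ?a + sqrt ?b)" by (rule abs_diff_sqrt[OF pos])
  also have "\<dots> \<le> (\<bar>x (n - 1) - y (n - 1)\<bar> + \<bar>x (n + 1) - y (n + 1)\<bar>) / (sqrt ?a + sqrt ?b)"
    using pos by (intro divide_right_mono) auto
  finally show ?thesis using abs_solve assms by simp
qed

section \<open>Two steps contract\<close>

definition rate :: real where
  "rate = sqrt (2 / (c\<^sup>2 * R))"

lemma rate_bounds: "0 \<le> rate" "rate < 1"
  using contracting R_ge_2 c_pos by (auto simp: rate_def)

text \<open>Here \<open>a\<close> and \<open>b\<close> stand for the mean moduli of two sequences after the first step, at the two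
  neighbours of a given time, and \<open>P\<close> and \<open>Q\<close> for the two moduli at that time after the second
  step. The number \<open>t\<close> in the proof measures how far \<open>a\<close> and \<open>b\<close> stay below \<open>R\<close>. It
  enlarges the right-hand side and compensates for the reciprocals on the left.\<close>

lemma contraction_inequality:
  assumes "c \<le> a" "a \<le> R" "c \<le> b" "b \<le> R" "0 \<le> P" "0 \<le> Q"
    and PQ: "2 * (c\<^sup>2 + 2 * R - a - b) \<le> P\<^sup>2 + Q\<^sup>2"
  shows "1 / a + 1 / b \<le> rate * (P + Q)"
proof -
  define t where "t = 2 * R - a - b"
  have t: "0 \<le> t" "t \<le> 2 * R" using assms c_pos by (auto simp: t_def)
  have cR: "0 < c * R" using c_pos R_ge_2 by simp
  have "1 / a + 1 / b \<le> (c + R - a) / (c * R) + (c + R - b) / (c * R)"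
    using inverse_le_chord[of c a R] inverse_le_chord[of c b R] assms c_pos by linarith
  also have "\<dots> = (2 * c + t) / (c * R)" by (simp add: t_def add_divide_distrib[symmetric])
  also have "\<dots> \<le> rate * (P + Q)"
  proof (rule power2_le_imp_le)
    have "(2 * c + t)\<^sup>2 \<le> 8 * c\<^sup>2 + 2 * t\<^sup>2"
      using zero_le_power2[of "2 * c - t"] by (simp add: power2_eq_square algebra_simps)
    also have "\<dots> \<le> 4 * R * (c\<^sup>2 + t)"
    proof -
      have "2 * c\<^sup>2 \<le> R * c\<^sup>2" using R_ge_2 by (intro mult_right_mono) auto
      moreover have "t * t \<le> 2 * R * t" using t by (intro mult_right_mono) auto
      ultimately show ?thesis by (simp add: power2_eq_square algebra_simps)
    qed
    finally have "((2 * c + t) / (c * R))\<^sup>2 \<le> 4 * R * (c\<^sup>2 + t) / (c * R)\<^sup>2"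
      unfolding power_divide by (intro divide_right_mono) auto
    also have "\<dots> = 2 / (c\<^sup>2 * R) * (2 * (c\<^sup>2 + t))"
      using c_pos R_ge_2 by (simp add: power2_eq_square field_simps)
    also have "\<dots> \<le> 2 / (c\<^sup>2 * R) * (P + Q)\<^sup>2"
    proof (rule mult_left_mono)
      have "2 * (c\<^sup>2 + t) \<le> P\<^sup>2 + Q\<^sup>2" using PQ by (simp add: t_def algebra_simps)
      also have "\<dots> \<le> (P + Q)\<^sup>2" using assms by (simp add: power2_sum)
      finally show "2 * (c\<^sup>2 + t) \<le> (P + Q)\<^sup>2" .
    qed (use R_ge_2 in auto)
    also have "\<dots> = (rate * (P + Q))\<^sup>2"
      using R_ge_2 by (simp add: rate_def power_mult_distrib)
    finally show "((2 * c + t) / (c * R))\<^sup>2 \<le> (rate * (P + Q))\<^sup>2" .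
    show "0 \<le> rate * (P + Q)" using rate_bounds assms by simp
  qed
  finally show ?thesis .
qed

text \<open>The hypotheses concern a window around \<open>n\<close> only. This serves both global questions, with
  equal codes, and the dependence of the orbit on distant symbols.\<close>

lemma solve_solve_diff:
  assumes x: "in_box x" and y: "in_box y"
    and st: "\<And>k. \<bar>k - n\<bar> \<le> 1 \<Longrightarrow> s k = t k"
    and K: "\<And>k. \<bar>k - n\<bar> \<le> 2 \<Longrightarrow> \<bar>x k - y k\<bar> \<le> K"
  shows "\<bar>solve s (solve s x) n - solve t (solve t y) n\<bar> \<le> rate * K"
proof -
  let ?u = "solve s x" and ?v = "solve t y"
  let ?P = "\<bar>solve s ?u n\<bar>" and ?Q = "\<bar>solve t ?v n\<bar>"
  define a where "a = (\<bar>?u (n - 1)\<bar> + \<bar>?v (n - 1)\<bar>) / 2"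
  define b where "b = (\<bar>?u (n + 1)\<bar> + \<bar>?v (n + 1)\<bar>) / 2"
  have box: "in_box ?u" "in_box ?v" using x y in_box_solve by auto
  have ab: "c \<le> a" "a \<le> R" "c \<le> b" "b \<le> R"
    using abs_solve_bounds[OF x, of s "n - 1"] abs_solve_bounds[OF y, of t "n - 1"]
      abs_solve_bounds[OF x, of s "n + 1"] abs_solve_bounds[OF y, of t "n + 1"]
    unfolding a_def b_def by argo+
  have PQ: "c \<le> ?P" "c \<le> ?Q" using abs_solve_bounds(1) box by auto
  have K0: "0 \<le> K" using K[of n] by simp
  have "?u (n - 1) + ?v (n - 1) \<le> 2 * a" "?u (n + 1) + ?v (n + 1) \<le> 2 * b"
    by (simp_all add: a_def b_def add_mono)
  hence "2 * (c\<^sup>2 + 2 * R - a - b) \<le> ?P\<^sup>2 + ?Q\<^sup>2"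
    unfolding power2_abs solve_square[OF box(1)] solve_square[OF box(2)]
    using lower[of n] by argo
  hence ineq: "1 / a + 1 / b \<le> rate * (?P + ?Q)"
    by (intro contraction_inequality) (use ab in auto)
  have step: "\<bar>?u m - ?v m\<bar> \<le> K / ((\<bar>?u m\<bar> + \<bar>?v m\<bar>) / 2)" if "\<bar>m - n\<bar> = 1" for m
  proof -
    have "\<bar>x (m - 1) - y (m - 1)\<bar> \<le> K" "\<bar>x (m + 1) - y (m + 1)\<bar> \<le> K"
      using that by (auto intro!: K)
    hence "(\<bar>x (m - 1) - y (m - 1)\<bar> + \<bar>x (m + 1) - y (m + 1)\<bar>) / (\<bar>?u m\<bar> + \<bar>?v m\<bar>)
      \<le> (2 * K) / (\<bar>?u m\<bar> + \<bar>?v m\<bar>)"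
      by (intro divide_right_mono) auto
    thus ?thesis using solve_diff[OF x y, of s m t] st[of m] that by (simp add: mult.commute)
  qed
  have "\<bar>solve s ?u n - solve t ?v n\<bar> \<le>
      (\<bar>?u (n - 1) - ?v (n - 1)\<bar> + \<bar>?u (n + 1) - ?v (n + 1)\<bar>) / (?P + ?Q)"
    by (rule solve_diff[OF box]) (simp add: st)
  also have "\<dots> \<le> (K / a + K / b) / (?P + ?Q)"
    using step[of "n - 1"] step[of "n + 1"]
    by (intro divide_right_mono add_mono) (auto simp: a_def b_def)
  also have "\<dots> = K * (1 / a + 1 / b) / (?P + ?Q)" by (simp add: algebra_simps)
  also have "\<dots> \<le> K * (rate * (?P + ?Q)) / (?P + ?Q)"
    using ineq K0 by (intro divide_right_mono mult_left_mono) auto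
  also have "\<dots> = rate * K" using PQ c_pos by simp
  finally show ?thesis .
qed

section \<open>One orbit for each code\<close>

definition coded_orbit :: "(int \<Rightarrow> nat) \<Rightarrow> (int \<Rightarrow> real) \<Rightarrow> bool" where
  "coded_orbit s x \<longleftrightarrow> in_box x \<and> solve s x = x"

text \<open>Both sequences are fixed by their operators, so \<open>solve_solve_diff\<close> can be iterated. Each
  use gains a factor \<open>rate\<close> and loses two symbols at either end of the window.\<close>

lemma coded_orbits_close:
  assumes "coded_orbit s x" "coded_orbit t y"
    and "\<And>k. \<bar>k - n\<bar> \<le> 2 * int m \<Longrightarrow> s k = t k"
  shows "\<bar>x n - y n\<bar> \<le> 2 * R * rate ^ m"
  using assms(3)
proof (induction m arbitrary: n)
  case 0
  have "\<bar>x n\<bar> \<le> R" "\<bar>y n\<bar> \<le> R" using assms by (auto simp: coded_orbit_def in_box_def)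
  thus ?case by simp
next
  case (Suc m)
  have "\<bar>solve s (solve s x) n - solve t (solve t y) n\<bar> \<le> rate * (2 * R * rate ^ m)"
  proof (rule solve_solve_diff)
    show "\<bar>x k - y k\<bar> \<le> 2 * R * rate ^ m" if "\<bar>k - n\<bar> \<le> 2" for k
      by (rule Suc.IH, rule Suc.prems) (use that in auto)
    show "s k = t k" if "\<bar>k - n\<bar> \<le> 1" for k
      using that by (intro Suc.prems) auto
  qed (use assms in \<open>auto simp: coded_orbit_def\<close>)
  thus ?case using assms by (simp add: coded_orbit_def algebra_simps)
qed

lemma rate_tendsto_0: "(\<lambda>m. 2 * R * rate ^ m) \<longlonglongrightarrow> 0"
  using rate_bounds by (intro tendsto_mult_right_zero LIMSEQ_realpow_zero)

lemma coded_orbit_unique: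
  assumes "coded_orbit s x" "coded_orbit s y"
  shows "x = y"
proof
  fix n
  have "\<bar>x n - y n\<bar> \<le> 0"
    by (rule LIMSEQ_le_const[OF rate_tendsto_0]) (use coded_orbits_close[OF assms] in auto)
  thus "x n = y n" by simp
qed

text \<open>Picard iteration, started at the zero sequence. As only pairs of steps contract, an iterate of
  any later index is compared with the one of index \<open>2 * m\<close>. The limit of the values at each
  single time suffices, because the operator at a given time involves just two other times.\<close>

lemma coded_orbit_exists: "\<exists>x. coded_orbit s x"
proof -
  define X where "X k = (solve s ^^ k) (\<lambda>_. 0)" for k
  have X_Suc: "X (Suc k) = solve s (X k)" for k by (simp add: X_def)
  have box: "in_box (X k)" for k
    using R_ge_2 by (induction k) (auto simp: X_Suc in_box_solve, simp add: X_def in_box_def)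
  have close: "\<bar>X (k + 2 * m) n - X (2 * m) n\<bar> \<le> 2 * R * rate ^ m" for k m n
  proof (induction m arbitrary: n)
    case 0
    have "\<bar>X k n\<bar> \<le> R" "\<bar>X 0 n\<bar> \<le> R" using box by (auto simp: in_box_def)
    thus ?case by simp
  next
    case (Suc m)
    have "\<bar>solve s (solve s (X (k + 2 * m))) n - solve s (solve s (X (2 * m))) n\<bar>
        \<le> rate * (2 * R * rate ^ m)"
      by (rule solve_solve_diff) (use Suc box in auto)
    thus ?case by (simp add: X_Suc algebra_simps)
  qed
  have "Cauchy (\<lambda>k. X k n)" for n
  proof (rule CauchyI')
    fix e :: real assume "e > 0"
    hence "\<forall>\<^sub>F m in sequentially. 2 * R * rate ^ m < e / 2"
      by (intro order_tendstoD(2)[OF rate_tendsto_0]) auto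
    then obtain m where m: "2 * R * rate ^ m < e / 2"
      by (auto simp: eventually_sequentially)
    have near: "\<bar>X k n - X (2 * m) n\<bar> < e / 2" if "k \<ge> 2 * m" for k
      using close[of "k - 2 * m" m n] m that by simp
    show "\<exists>M. \<forall>k\<ge>M. \<forall>l>k. dist (X k n) (X l n) < e"
    proof (intro exI allI impI)
      fix k l assume "k \<ge> 2 * m" "l > k"
      hence "\<bar>X k n - X (2 * m) n\<bar> < e / 2" "\<bar>X l n - X (2 * m) n\<bar> < e / 2"
        using near[of k] near[of l] by linarith+
      thus "dist (X k n) (X l n) < e" unfolding dist_real_def by linarith
    qed
  qed
  hence "\<exists>l. (\<lambda>k. X k n) \<longlonglongrightarrow> l" for n by (simp add: Cauchy_convergent_iff convergent_def)
  then obtain x where lim: "\<And>n. (\<lambda>k. X k n) \<longlonglongrightarrow> x n" by metis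
  have "in_box x"
    unfolding in_box_def
  proof
    fix n
    show "\<bar>x n\<bar> \<le> R"
      by (rule LIMSEQ_le_const2[OF tendsto_rabs[OF lim]]) (use box in \<open>auto simp: in_box_def\<close>)
  qed
  moreover have "solve s x = x"
  proof
    fix n
    have "(\<lambda>k. solve s (X k) n) \<longlonglongrightarrow> solve s x n"
      unfolding solve_def by (intro tendsto_intros lim)
    moreover have "(\<lambda>k. solve s (X k) n) \<longlonglongrightarrow> x n"
      using LIMSEQ_Suc[OF lim[of n]] by (simp add: X_Suc)
    ultimately show "solve s x n = x n" by (rule LIMSEQ_unique)
  qed
  ultimately show ?thesis by (auto simp: coded_orbit_def)
qed

definition orbit :: "(int \<Rightarrow> nat) \<Rightarrow> int \<Rightarrow> real" where
  "orbit s = (THE x. coded_orbit s x)"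

lemma coded_orbit_orbit: "coded_orbit s (orbit s)"
proof -
  have "\<exists>!x. coded_orbit s x"
    by (rule ex_ex1I[OF coded_orbit_exists coded_orbit_unique])
  thus ?thesis unfolding orbit_def by (rule theI')
qed

lemma abs_orbit_bounds: "c \<le> \<bar>orbit s n\<bar>" "\<bar>orbit s n\<bar> \<le> R"
  using abs_solve_bounds[of "orbit s" s n] coded_orbit_orbit[of s]
  unfolding coded_orbit_def by simp_all

lemma sgn_orbit: "sgn (orbit s n) = symbol_sign (s n)"
proof -
  have "orbit s n = symbol_sign (s n) * sqrt (A n - orbit s (n - 1) - orbit s (n + 1))"
    using coded_orbit_orbit[of s] by (metis coded_orbit_def solve_def)
  moreover have "sqrt (A n - orbit s (n - 1) - orbit s (n + 1)) > 0"
  proof -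
    have "c\<^sup>2 \<le> A n - orbit s (n - 1) - orbit s (n + 1)"
      using coded_orbit_orbit[of s] by (intro radicand_bounds(1)) (simp add: coded_orbit_def)
    moreover have "0 < c\<^sup>2" using c_pos by simp
    ultimately have "0 < A n - orbit s (n - 1) - orbit s (n + 1)" by linarith
    thus ?thesis by simp
  qed
  ultimately have "sgn (orbit s n) = sgn (symbol_sign (s n))"
    by (metis mult.right_neutral sgn_mult sgn_pos)
  thus ?thesis by (simp add: symbol_sign_def)
qed

lemma orbit_recurrence: "orbit s (n + 1) = A n - orbit s (n - 1) - (orbit s n)\<^sup>2"
  using solve_square[of "orbit s" s n] coded_orbit_orbit[of s]
  by (simp add: coded_orbit_def)

text \<open>The recurrence has order two and can be solved for its last and for its first term.\<close>

lemma orbit_eqI: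
  assumes eq: "orbit s n = orbit t n" "orbit s (n - 1) = orbit t (n - 1)"
  shows "orbit s = orbit t"
proof -
  have fwd: "orbit s m = orbit t m \<and> orbit s (m - 1) = orbit t (m - 1)" if "m \<ge> n" for m
    using that
  proof (induction m rule: int_ge_induct)
    case (step m)
    thus ?case using orbit_recurrence[of s m] orbit_recurrence[of t m] by simp
  qed (use eq in simp)
  have bwd: "orbit s m = orbit t m \<and> orbit s (m - 1) = orbit t (m - 1)" if "m \<le> n" for m
    using that
  proof (induction m rule: int_le_induct)
    case (step m)
    thus ?case using orbit_recurrence[of s "m - 1"] orbit_recurrence[of t "m - 1"] by simp
  qed (use eq in simp)
  show ?thesis
  proof
    fix m show "orbit s m = orbit t m" using fwd[of m] bwd[of m] by linarith
  qed
qed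

section \<open>The coding map\<close>

text \<open>A code at time \<open>n\<close> carries the symbol of time \<open>n + k\<close> at index \<open>k\<close>, whereas \<open>orbit\<close>
  takes sequences indexed by absolute time; hence the reindexing by \<open>m - n\<close>.\<close>

definition coding_point :: "int \<Rightarrow> (int \<Rightarrow> nat) \<Rightarrow> plane" where
  "coding_point n s =
     (orbit (\<lambda>m. s (m - n)) n, orbit (\<lambda>m. s (m - n)) (n - 1))"

lemma henon_coding_point: "henon A n (coding_point n s) = coding_point (n + 1) (shift s)"
proof -
  have "(\<lambda>m. shift s (m - (n + 1))) = (\<lambda>m. s (m - n))" by (simp add: shift_def)
  thus ?thesis
    by (simp only: coding_point_def henon_def orbit_recurrence) (simp add: orbit_recurrence)
qed

lemma inj_on_coding_point: "inj_on (coding_point n) (full_shift 2)"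
proof (rule inj_onI)
  fix s t
  assume s: "s \<in> full_shift 2" and t: "t \<in> full_shift 2"
    and "coding_point n s = coding_point n t"
  hence eq: "orbit (\<lambda>m. s (m - n)) = orbit (\<lambda>m. t (m - n))"
    by (auto simp: coding_point_def intro: orbit_eqI)
  show "s = t"
  proof
    fix k
    have "symbol_sign (s k) = symbol_sign (t k)"
      using sgn_orbit[of "\<lambda>m. s (m - n)" "k + n"] sgn_orbit[of "\<lambda>m. t (m - n)" "k + n"] eq
      by simp
    thus "s k = t k"
      using s t by (auto simp: full_shift_def intro: inj_onD[OF inj_on_symbol_sign])
  qed
qed

lemma continuous_on_orbit:
  "continuous_on S (\<lambda>s. orbit (\<lambda>m. s (m - n)) j)"
  unfolding continuous_on_def tendsto_iff
proof (intro ballI allI impI)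
  fix s :: "int \<Rightarrow> nat" and e :: real
  assume "e > 0"
  hence "\<forall>\<^sub>F m in sequentially. 2 * R * rate ^ m < e"
    by (intro order_tendstoD(2)[OF rate_tendsto_0])
  then obtain m where m: "2 * R * rate ^ m < e"
    by (auto simp: eventually_sequentially)
  define F where "F = {j - n - 2 * int m .. j - n + 2 * int m}"
  have "dist (orbit (\<lambda>m. t (m - n)) j) (orbit (\<lambda>m. s (m - n)) j) < e"
    if "\<forall>k\<in>F. t k = s k" for t
  proof -
    have "\<bar>orbit (\<lambda>m. t (m - n)) j - orbit (\<lambda>m. s (m - n)) j\<bar> \<le> 2 * R * rate ^ m"
      by (rule coded_orbits_close[OF coded_orbit_orbit coded_orbit_orbit])
         (use that in \<open>auto simp: F_def abs_le_iff\<close>)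
    thus ?thesis using m by (simp add: dist_real_def)
  qed
  moreover have "open {t. \<forall>k\<in>F. t k = s k}" by (rule open_cylinder) (simp add: F_def)
  ultimately show "\<forall>\<^sub>F t in at s within S.
      dist (orbit (\<lambda>m. t (m - n)) j) (orbit (\<lambda>m. s (m - n)) j) < e"
    unfolding eventually_at_topological
    by (intro exI[of _ "{t. \<forall>k\<in>F. t k = s k}"]) auto
qed

lemma continuous_on_coding_point: "continuous_on S (coding_point n)"
  unfolding coding_point_def by (intro continuous_intros continuous_on_orbit)

section \<open>The square, its strips and the chaotic set\<close>

definition square :: "plane set" where
  "square = cbox (- R, - R) (R, R)"

definition strip :: "nat \<Rightarrow> plane set" where
  "strip i = (if i = 1 then {c..R} \<times> {- R..R} else {- R..- c} \<times> {- R..R})"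

lemma closed_bounded_domains_square: "closed_bounded_domains (\<lambda>_. square)"
proof -
  let ?U = "box (- R, - R) (R, R)"
  have "(0, 0) \<in> ?U" using R_ge_2 by (simp add: mem_box Basis_prod_def)
  hence "?U \<noteq> {}" by blast
  hence "open ?U \<and> connected ?U \<and> ?U \<noteq> {} \<and> square = closure ?U"
    by (simp add: square_def open_box closure_box convex_connected del: box_eq_empty)
  moreover have "bounded (\<Union>n::int. square)" by (simp add: square_def bounded_cbox)
  ultimately show ?thesis unfolding closed_bounded_domains_def by blast
qed

lemma square_eq: "square = {- R..R} \<times> {- R..R}"
  by (simp add: square_def cbox_Pair_eq)

lemma vertical_strips_strip: "vertical_strips 0 2 (\<lambda>_. square) (\<lambda>_. strip)"
proof -
  have half: "vertical_strip 0 square ({l..r} \<times> {- R..R})" if "- R \<le> l" "l < r" "r \<le> R" for l r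
    unfolding vertical_strip_def
    by (rule exI[of _ "- R"], rule exI[of _ R], rule exI[of _ "\<lambda>_. l"], rule exI[of _ "\<lambda>_. r"])
       (use that R_ge_2 in \<open>auto simp: square_eq lipschitz_on_def\<close>)
  have "vertical_strip 0 square (strip i)" for i
    using half[of c R] half[of "- R" "- c"] c_pos c_less_R by (auto simp: strip_def)
  moreover have "strip i \<subseteq> square" for i
    using c_pos c_less_R by (auto simp: strip_def square_eq)
  moreover have "strip i \<inter> strip j = {}" if "i \<in> {1..2}" "j \<in> {1..2}" "i \<noteq> j" for i j
    using that c_pos by (auto simp: strip_def)
  ultimately show ?thesis unfolding vertical_strips_def by blast
qed

lemma coding_point_in_square: "coding_point n s \<in> square"
  using abs_orbit_bounds(2) by (auto simp: coding_point_def square_eq abs_le_iff minus_le_iff)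

lemma coding_point_in_strip:
  "coding_point n s \<in> strip (s 0)"
proof -
  let ?x = "orbit (\<lambda>m. s (m - n)) n"
  have "sgn ?x = symbol_sign (s 0)" using sgn_orbit[of "\<lambda>m. s (m - n)" n] by simp
  moreover have "c \<le> \<bar>?x\<bar>" "\<bar>?x\<bar> \<le> R" by (rule abs_orbit_bounds)+
  ultimately have "?x \<in> (if s 0 = 1 then {c..R} else {- R..- c})"
    by (auto simp: symbol_sign_def sgn_if split: if_splits)
  moreover have "orbit (\<lambda>m. s (m - n)) (n - 1) \<in> {- R..R}"
    using coding_point_in_square[of n s] by (auto simp: coding_point_def square_eq)
  ultimately show ?thesis by (auto simp: coding_point_def strip_def)
qed

text \<open>The coding itself supplies the points that make a transition: an orbit whose code has the
  two wanted symbols in succession.\<close>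

lemma transition_matrix_strip:
  "transition_matrix (henon A) (\<lambda>_. strip) n i j = 1"
proof -
  define s :: "int \<Rightarrow> nat" where "s k = (if k = 0 then i else j)" for k
  have "coding_point n s \<in> strip i"
    using coding_point_in_strip[of n s] by (simp add: s_def)
  moreover have "henon A n (coding_point n s) \<in> strip j"
    using coding_point_in_strip[of "n + 1" "shift s"]
    by (simp add: henon_coding_point shift_def s_def)
  ultimately have "henon A n ` strip i \<inter> strip j \<noteq> {}" by blast
  thus ?thesis by (simp add: transition_matrix_def)
qed

lemma symbol_space_strip:
  "symbol_space 2 (transition_matrix (henon A) (\<lambda>_. strip)) n = full_shift 2"
  by (simp add: symbol_space_def transition_matrix_strip full_shift_def)

lemma shift_image: "shift ` full_shift N = full_shift N"
proof (intro equalityI subsetI)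
  fix s assume "s \<in> full_shift N"
  hence "(\<lambda>k. s (k - 1)) \<in> full_shift N" "s = shift (\<lambda>k. s (k - 1))"
    by (auto simp: full_shift_def shift_def)
  thus "s \<in> shift ` full_shift N" by blast
qed (auto simp: full_shift_def shift_def)

text \<open>The homeomorphism is obtained in the direction from codes to points, where compactness of
  the codes makes continuity of the inverse automatic. The conjugacy is \<open>henon_coding_point\<close>.\<close>

lemma chaotic_set:
  "nonautonomous_chaotic_set (henon A) (\<lambda>_. square) 2
     (transition_matrix (henon A) (\<lambda>_. strip)) (\<lambda>n. coding_point n ` full_shift 2)"
proof -
  have "\<exists>\<phi>. homeomorphism (full_shift 2) (coding_point n ` full_shift 2) (coding_point n) \<phi>"
    for n
    by (intro homeomorphism_compact compact_full_shift continuous_on_coding_point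
        inj_on_coding_point refl)
  then obtain \<phi> where \<phi>: "\<And>n. homeomorphism (full_shift 2)
      (coding_point n ` full_shift 2) (coding_point n) (\<phi> n)" by metis
  have \<phi>_point: "\<phi> n (coding_point n s) = s" if "s \<in> full_shift 2" for n s
    using \<phi> that by (auto simp: homeomorphism_def)
  have invariant: "henon A n ` coding_point n ` full_shift 2 =
      coding_point (n + 1) ` full_shift 2" for n
  proof -
    have "henon A n ` coding_point n ` full_shift 2 =
        coding_point (n + 1) ` shift ` full_shift 2"
      by (simp add: image_image henon_coding_point)
    thus ?thesis by (simp add: shift_image)
  qed
  have "\<phi> (n + 1) (henon A n p) = shift (\<phi> n p)" if "p \<in> coding_point n ` full_shift 2" for n p
  proof -
    obtain s where s: "s \<in> full_shift 2" "p = coding_point n s" using \<open>p \<in> _\<close> by blast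
    have "shift s \<in> full_shift 2" using s shift_image by blast
    thus ?thesis using s by (simp add: henon_coding_point \<phi>_point)
  qed
  thus ?thesis
    unfolding nonautonomous_chaotic_set_def symbol_space_strip
    using invariant coding_point_in_square homeomorphism_symD[OF \<phi>]
    by (intro conjI exI[of _ \<phi>] exI[of _ coding_point]) auto
qed

end

section \<open>The parameters of the oscillating map\<close>

theorem theorem6:
  fixes Astar \<epsilon> :: real and A :: "int \<Rightarrow> real"
  assumes "Astar \<ge> 9.5" and "\<epsilon> = 0.1"
    and "\<And>n. A n = Astar + \<epsilon> * cos (of_int n)"
  shows "\<exists>\<mu> D V \<Lambda>.
           closed_bounded_domains D \<and>
           vertical_strips \<mu> 2 D V \<and>
           (\<forall>n. \<forall>i\<in>{1..2}. \<forall>j\<in>{1..2}. transition_matrix (henon A) V n i j = 1) \<and>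
           nonautonomous_chaotic_set (henon A) D 2 (transition_matrix (henon A) V) \<Lambda>"
proof -
  \<comment> \<open>\<open>R\<close> is the positive root of \<open>R\<^sup>2 = 2 * R + (Astar + 0.1)\<close>, so that the operator just maps
    the box into itself.\<close>
  define R where "R = 1 + sqrt (Astar + 1.1)"
  define c where "c = sqrt (Astar - 0.1 - 2 * R)"
  have "3.25 \<le> sqrt (Astar + 1.1)"
    using assms(1) by (intro real_le_rsqrt) (simp add: power2_eq_square)
  hence R_ge: "R \<ge> 4.25" by (simp add: R_def)
  have "(R - 1)\<^sup>2 = Astar + 1.1" using assms(1) by (simp add: R_def)
  hence R_eq: "R\<^sup>2 - 2 * R = Astar + 0.1" by (simp add: power2_eq_square algebra_simps)
  \<comment> \<open>By the equation for \<open>R\<close>, the number \<open>c\<^sup>2\<close> is \<open>R * (R - 4) - 0.2\<close>, which increases with \<open>R\<close>.\<close>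
  have "4.25 * 0.25 \<le> R * (R - 4)" using R_ge by (intro mult_mono) auto
  hence gap: "0.8 \<le> Astar - 0.1 - 2 * R" using R_eq by (simp add: power2_eq_square algebra_simps)
  hence c2: "c\<^sup>2 = Astar - 0.1 - 2 * R" by (simp add: c_def)
  have A_bounds: "Astar - 0.1 \<le> A n" "A n \<le> Astar + 0.1" for n
    using assms(3)[of n] cos_ge_minus_one[of "real_of_int n"] cos_le_one[of "real_of_int n"]
    unfolding assms(2) by linarith+
  interpret henon_horseshoe A R c
  proof
    show "c > 0" using gap by (simp add: c_def)
    show "A n \<le> R\<^sup>2 - 2 * R" for n using A_bounds(2)[of n] R_eq by simp
    show "c\<^sup>2 + 2 * R \<le> A n" for n using A_bounds(1)[of n] c2 by simp
    show "R \<ge> 2" using R_ge by simp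
    have "0.8 * 4.25 \<le> c\<^sup>2 * R" using gap c2 R_ge by (intro mult_mono) auto
    thus "2 < c\<^sup>2 * R" by simp
  qed
  show ?thesis
    using closed_bounded_domains_square vertical_strips_strip transition_matrix_strip chaotic_set
    by blast
qed

end
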